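(* Let $\phi$ be a strictly increasing convex function on $[0,\infty)$ with $\phi(0)=0$, let $\Lambda=\{\lambda_j\}_{j\ge1}$ be a Waterman sequence, let $\{q_n\}_{n\ge1}$ be a sequence of real numbers with $1\le q_n\uparrow q\le\infty$, and let $\{\delta_n\}_{n\ge1}$ be a sequence of real numbers with $2\le\delta_n\uparrow\infty$. Then the embedding $\phi\Lambda\mathrm{BV}\subseteq\mathrm{BV}^{(q_n\uparrow q)}$ holds if and only if $$\limsup_{n\to\infty}\ \max_{1\le k\le\delta_n}k^{\frac1{q_n}}\,\phi^{-1}\big(\Lambda(k)^{-1}\big)<\infty ,$$ where the maximum is over integers $k$.
   Context: A Waterman sequence is a nondecreasing sequence $\Lambda=\{\lambda_j\}_{j=1}^\infty$ of positive numbers with $\sum_{j=1}^\infty 1/\lambda_j=\infty$. For integers $k\ge1$, $\Lambda(k):=\sum_{j=1}^{k}1/\lambda_j$. The function $\phi$ is real-valued and $\phi^{-1}$ is its inverse function. The notation $q_n\uparrow q$ means that $\{q_n\}$ is nondecreasing (possibly constant) with limit $q$; $\delta_n\uparrow\infty$ means nondecreasing with limit $\infty$. All functions $f$ below are real-valued on $[0,1]$. For an interval $I\subseteq[0,1]$, $f(I):=f(\sup I)-f(\inf I)$ and $|I|$ is its length. $\phi\Lambda\mathrm{BV}$ is the linear space of all $f$ such that for some $c>0$, $\sup\sum_{j=1}^s\phi(c|f(I_j)|)/\lambda_j<\infty$, the supremum being over all finite (ordered) collections $\{I_j\}_{j=1}^s$ of nonoverlapping subintervals of $[0,1]$. $\mathrm{BV}^{(q_n\uparrow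 q)}$ (depending also on $\{\delta_n\}$) is the set of all $f$ such that $$\sup_{n\ge1}\ \sup_{\{I_j\}}\Big(\sum_{j=1}^s|f(I_j)|^{q_n}\Big)^{1/q_n}<\infty,$$ where, for each $n$, the inner supremum is over all finite collections $\{I_j\}_{j=1}^s$ of nonoverlapping subintervals of $[0,1]$ with $\inf_j|I_j|\ge 1/\delta_n$. *)

theory Defs
  imports "HOL-Analysis.Analysis"
begin

text \<open>All sequences are indexed from 1; the value at index 0 is never used.\<close>

definition waterman_sum :: "(nat \<Rightarrow> real) \<Rightarrow> nat \<Rightarrow> real" where
  "waterman_sum lam k = (\<Sum>j=1..k. 1 / lam j)"

definition waterman_seq :: "(nat \<Rightarrow> real) \<Rightarrow> bool" where
  "waterman_seq lam \<longleftrightarrow> mono_on {1..} lam \<and> (\<forall>j\<ge>1. lam j > 0) \<and>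
     filterlim (waterman_sum lam) at_top sequentially"

definition increment :: "(real \<Rightarrow> real) \<Rightarrow> real set \<Rightarrow> real" where
  "increment f I = f (Sup I) - f (Inf I)"

definition len :: "real set \<Rightarrow> real" where
  "len I = Sup I - Inf I"

text \<open>
  An ordered finite collection \<open>I 1, \<dots>, I s\<close> of subintervals of \<open>[0,1]\<close>. The intervals may be
  open, closed or half-open, and come in any order. Nonoverlapping means having disjoint
  interiors. Degenerate intervals are admitted; their increments are 0.
\<close>
definition nonoverlapping_intervals :: "nat \<Rightarrow> (nat \<Rightarrow> real set) \<Rightarrow> bool" where
  "nonoverlapping_intervals s I \<longleftrightarrow>
     (\<forall>j\<in>{1..s}. is_interval (I j) \<and> I j \<noteq> {} \<and> I j \<subseteq> {0..1}) \<and>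
     (\<forall>i\<in>{1..s}. \<forall>j\<in>{1..s}. i \<noteq> j \<longrightarrow> interior (I i) \<inter> interior (I j) = {})"

text \<open>
  Functions on \<open>[0,1]\<close> are represented by total functions on the reals. Membership in either
  class below depends only on the values on \<open>[0,1]\<close>, so inclusions between the classes are
  not affected.
\<close>
definition phi_Lambda_BV :: "(real \<Rightarrow> real) \<Rightarrow> (nat \<Rightarrow> real) \<Rightarrow> (real \<Rightarrow> real) set" where
  "phi_Lambda_BV \<phi> lam = {f. \<exists>c>0.
     (SUP (s, I) \<in> {(s, I). nonoverlapping_intervals s I}.
        ereal (\<Sum>j=1..s. \<phi> (c * \<bar>increment f (I j)\<bar>) / lam j)) < \<infinity>}"

text \<open>The limit of the exponents does not enter the definition of this class.\<close>
definition BV_seq :: "(nat \<Rightarrow> real) \<Rightarrow> (nat \<Rightarrow> real) \<Rightarrow> (real \<Rightarrow> real) set" where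
  "BV_seq qs \<delta> = {f.
     (SUP n\<in>{1..}. SUP (s, I) \<in> {(s, I). nonoverlapping_intervals s I \<and>
                                          (\<forall>j\<in>{1..s}. len (I j) \<ge> 1 / \<delta> n)}.
        ereal ((\<Sum>j=1..s. \<bar>increment f (I j)\<bar> powr qs n) powr (1 / qs n))) < \<infinity>}"

end

theory Submission
  imports Defs
begin

text \<open>
  Write \<open>\<Lambda>(k)\<close> for \<open>waterman_sum lam k\<close> and \<open>\<psi>\<close> for the inverse of \<open>\<phi>\<close>. The number
  \<open>k powr (1/q) * \<psi> (1 / \<Lambda>(k))\<close> is the \<open>q\<close>-variation of \<open>k\<close> equal jumps whose height is the
  largest allowed by the constraint that the weighted sum of the \<open>\<phi>\<close>-values of the jumps be at most 1.
  So the theorem says that collections of equal jumps are, up to a constant that does not depend on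
  the exponent, the worst case.

  Sufficiency. For increments \<open>x 1 \<ge> x 2 \<ge> \<dots> \<ge> x s\<close> with \<open>(\<Sum>j=1..s. \<phi> (x j) / lam j) \<le> 1\<close>, the lemma
  \<open>powr_sum_le_of_weighted_gauge_sum_le\<close> bounds the \<open>q\<close>-variation by three times the largest of these
  numbers with \<open>k \<le> s\<close>. It compares the two sums after summation by parts, one drop of the sequence
  at a time, using the convexity of \<open>\<phi>\<close> and the concavity of \<open>k \<mapsto> \<Lambda>(k)\<close>. Intervals of length at
  least \<open>1 / \<delta> n\<close> number at most \<open>\<delta> n\<close>, so only indices \<open>k \<le> \<delta> n\<close> enter (\<open>powr_variation_le\<close>).

  Necessity. If the maxima are unbounded, the extremal configurations are superposed: layer \<open>i\<close> is an
  indicator function of about \<open>k / 2\<close> equally spaced rational points, of height \<open>\<psi> (1 / \<Lambda>(k))\<close>,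
  where \<open>k\<close> is chosen so that the number above exceeds \<open>4 ^ i\<close>, and it gets the weight
  \<open>(1/2) ^ Suc i\<close>. Jensen's inequality keeps the sum in the first class
  (\<open>spike_series_in_phi_Lambda_BV\<close>). Testing on intervals from a spike to an irrational point, where
  the sum vanishes, shows that the layers cannot cancel each other, so that the variation is infinite
  (\<open>ex_phi_Lambda_BV_not_BV_seq\<close>).
\<close>

section \<open>Convex gauge functions\<close>

text \<open>Bernoulli's inequality with a real exponent. It is used twice: to compare a drop of
  \<open>x powr q\<close> with the relative drop of \<open>x\<close>, and to absorb a constant linear in \<open>q\<close> into \<open>3 powr q\<close>,
  which makes the final bound uniform in \<open>q\<close>.\<close>

lemma powr_above_tangent:
  fixes r q :: real
  assumes "1 \<le> q" "0 \<le> r"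
  shows "1 + q * (r - 1) \<le> r powr q"
proof (cases "r = 0")
  case False
  have "((\<lambda>x::real. x powr q) has_field_derivative q) (at 1 within {0<..})"
    by (auto intro!: derivative_eq_intros)
  then have "r powr q - 1 powr q \<ge> q * (r - 1)"
    using False assms
    by (intro convex_on_imp_above_tangent[OF powr_convex]) (auto simp: interior_open)
  then show ?thesis by simp
qed (use assms in auto)

lemma convex_at_zero_star_shaped:
  fixes \<phi> :: "real \<Rightarrow> real"
  assumes "convex_on {0..} \<phi>" "\<phi> 0 = 0" "0 \<le> t" "t \<le> 1" "0 \<le> x"
  shows "\<phi> (t * x) \<le> t * \<phi> x"
  using convex_onD[OF assms(1,3,4), of 0 x] assms by simp

lemma gauge_nonneg:
  fixes \<phi> :: "real \<Rightarrow> real"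
  assumes "strict_mono_on {0..} \<phi>" "\<phi> 0 = 0" "0 \<le> x"
  shows "0 \<le> \<phi> x"
  using strict_mono_on_leD[OF assms(1), of 0 x] assms by simp

lemma gauge_continuous:
  fixes \<phi> :: "real \<Rightarrow> real"
  assumes mono: "strict_mono_on {0..} \<phi>" and conv: "convex_on {0..} \<phi>" and zero: "\<phi> 0 = 0"
  shows "continuous_on {0..} \<phi>"
  unfolding continuous_on_eq_continuous_within
proof
  fix x :: real
  assume x: "x \<in> {0..}"
  show "continuous (at x within {0..}) \<phi>"
  proof (cases "x = 0")
    case False
    have "continuous_on {0<..} \<phi>"
      by (intro convex_on_continuous convex_on_subset[OF conv]) auto
    then have "isCont \<phi> x"
      using False x by (simp add: continuous_on_eq_continuous_at)
    then show ?thesis by (rule continuous_at_imp_continuous_at_within)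
  next
    case True
    \<comment> \<open>Near the origin the graph is squeezed between the axis and the chord over \<open>[0,1]\<close>.\<close>
    have "(\<phi> \<longlongrightarrow> 0) (at 0 within {0..})"
    proof (rule tendsto_sandwich)
      show "\<forall>\<^sub>F y in at 0 within {0..}. 0 \<le> \<phi> y"
        using gauge_nonneg[OF mono zero] by (auto simp: eventually_at_filter)
      have "\<phi> y \<le> y * \<phi> 1" if "0 \<le> y" "y \<le> 1" for y
        using convex_at_zero_star_shaped[OF conv zero, of y 1] that by simp
      then show "\<forall>\<^sub>F y in at 0 within {0..}. \<phi> y \<le> y * \<phi> 1"
        by (auto simp: eventually_at dist_real_def intro!: exI[of _ 1])
      show "((\<lambda>y. y * \<phi> 1) \<longlongrightarrow> 0) (at 0 within {0..})"
        by (auto intro!: tendsto_eq_intros)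
    qed auto
    then show ?thesis using True zero by (simp add: continuous_within)
  qed
qed

text \<open>A convex function that vanishes at the origin and is positive at 1 grows at least linearly
  beyond 1, so the intermediate value theorem reaches every level. Hence the inverse of \<open>\<phi>\<close> is
  defined on the whole half-line.\<close>

lemma gauge_surjective:
  fixes \<phi> :: "real \<Rightarrow> real"
  assumes mono: "strict_mono_on {0..} \<phi>" and conv: "convex_on {0..} \<phi>" and zero: "\<phi> 0 = 0"
    and y: "0 \<le> y"
  shows "y \<in> \<phi> ` {0..}"
proof -
  have pos: "0 < \<phi> 1"
    using strict_mono_onD[OF mono, of 0 1] zero by simp
  define X where "X = max 1 (y / \<phi> 1)"
  have X: "1 \<le> X" by (simp add: X_def)
  have "\<phi> 1 \<le> (1 / X) * \<phi> X"
    using convex_at_zero_star_shaped[OF conv zero, of "1 / X" X] X by simp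
  then have "X * \<phi> 1 \<le> \<phi> X" using X by (simp add: field_simps)
  moreover have "y \<le> X * \<phi> 1"
    using pos by (simp add: X_def field_simps max_def)
  ultimately have "y \<le> \<phi> X" by simp
  then have "\<exists>x\<ge>0. x \<le> X \<and> \<phi> x = y"
    using X y zero by (intro IVT' continuous_on_subset[OF gauge_continuous[OF mono conv zero]]) auto
  then show ?thesis by force
qed

lemma gauge_inverse:
  fixes \<phi> :: "real \<Rightarrow> real"
  assumes "strict_mono_on {0..} \<phi>" "convex_on {0..} \<phi>" "\<phi> 0 = 0" "0 \<le> y"
  shows "0 \<le> the_inv_into {0..} \<phi> y" "\<phi> (the_inv_into {0..} \<phi> y) = y"
proof -
  have inj: "inj_on \<phi> {0..}"
    using assms(1) by (rule strict_mono_on_imp_inj_on)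
  show "\<phi> (the_inv_into {0..} \<phi> y) = y"
    by (rule f_the_inv_into_f[OF inj gauge_surjective[OF assms]])
  show "0 \<le> the_inv_into {0..} \<phi> y"
    using the_inv_into_into[OF inj gauge_surjective[OF assms] subset_refl] by simp
qed

text \<open>The finite inequality, with the missing weight put on the origin, applies to the partial
  sums; continuity lets it pass to the limit.\<close>

lemma gauge_jensen_suminf:
  fixes \<phi> :: "real \<Rightarrow> real"
  assumes mono: "strict_mono_on {0..} \<phi>" and conv: "convex_on {0..} \<phi>" and zero: "\<phi> 0 = 0"
    and w: "w sums 1" "\<And>i. 0 \<le> w i" and a: "\<And>i. 0 \<le> a i"
    and sum: "summable (\<lambda>i. w i * a i)" and sum': "summable (\<lambda>i. w i * \<phi> (a i))"
  shows "\<phi> (\<Sum>i. w i * a i) \<le> (\<Sum>i. w i * \<phi> (a i))"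
proof (rule LIMSEQ_le_const2)
  have "(\<Sum>i. w i * a i) \<in> {0..}"
    using w a by (auto intro!: suminf_nonneg[OF sum])
  moreover have "(\<Sum>i<N. w i * a i) \<in> {0..}" for N
    using w a by (auto intro!: sum_nonneg)
  ultimately show "(\<lambda>N. \<phi> (\<Sum>i<N. w i * a i)) \<longlonglongrightarrow> \<phi> (\<Sum>i. w i * a i)"
    using gauge_continuous[OF mono conv zero]
    by (intro continuous_on_tendsto_compose[OF _ summable_LIMSEQ[OF sum]] always_eventually allI)
  have "\<phi> (\<Sum>i<N. w i * a i) \<le> (\<Sum>i. w i * \<phi> (a i))" for N
  proof -
    define b where "b i = (if i < N then w i else 1 - (\<Sum>i<N. w i))" for i
    define y where "y i = (if i < N then a i else 0)" for i
    have le1: "(\<Sum>i<N. w i) \<le> 1"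
      using sum_le_suminf[of w "{..<N}"] w by (auto simp: sums_iff)
    have split: "(\<Sum>i\<in>{..N}. g i) = (\<Sum>i<N. g i) + g N" for g :: "nat \<Rightarrow> real"
      by (simp add: lessThan_Suc_atMost[symmetric])
    have "\<phi> (\<Sum>i\<in>{..N}. b i *\<^sub>R y i) \<le> (\<Sum>i\<in>{..N}. b i * \<phi> (y i))"
    proof (rule convex_on_sum[OF _ _ conv])
      show "(\<Sum>i\<in>{..N}. b i) = 1" unfolding split by (simp add: b_def)
      show "0 \<le> b i" for i using w(2) le1 by (simp add: b_def)
      show "y i \<in> {0..}" for i using a by (simp add: y_def)
    qed auto
    then have "\<phi> (\<Sum>i<N. w i * a i) \<le> (\<Sum>i<N. w i * \<phi> (a i))"
      unfolding split by (simp add: b_def y_def zero)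
    also have "\<dots> \<le> (\<Sum>i. w i * \<phi> (a i))"
      using w a gauge_nonneg[OF mono zero] by (intro sum_le_suminf[OF sum']) auto
    finally show ?thesis .
  qed
  then show "\<exists>N. \<forall>n\<ge>N. \<phi> (\<Sum>i<n. w i * a i) \<le> (\<Sum>i. w i * \<phi> (a i))" by blast
qed

section \<open>Partial sums of the reciprocals of a Waterman sequence\<close>

lemma waterman_seq_pos: "waterman_seq lam \<Longrightarrow> 1 \<le> j \<Longrightarrow> 0 < lam j"
  by (simp add: waterman_seq_def)

lemma waterman_seq_reciprocal_antimono:
  assumes "waterman_seq lam" "1 \<le> i" "i \<le> j"
  shows "1 / lam j \<le> 1 / lam i"
  using assms by (intro divide_left_mono)
    (auto simp: waterman_seq_def monotone_on_def intro!: mult_pos_pos)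

lemma waterman_sum_pos:
  assumes "waterman_seq lam" "1 \<le> k"
  shows "0 < waterman_sum lam k"
  unfolding waterman_sum_def using assms waterman_seq_pos[OF assms(1)] by (intro sum_pos) auto

lemma waterman_sum_mono:
  assumes "waterman_seq lam" "i \<le> k"
  shows "waterman_sum lam i \<le> waterman_sum lam k"
  unfolding waterman_sum_def using assms waterman_seq_pos[OF assms(1)]
  by (intro sum_mono2) (auto intro: less_imp_le)

text \<open>The \<open>i\<close>-th smallest of several distinct positive indices is at least \<open>i\<close>, and the reciprocals
  decrease.\<close>

lemma sum_reciprocal_le_waterman_sum:
  assumes lam: "waterman_seq lam" and "finite J" "0 \<notin> J"
  shows "(\<Sum>j\<in>J. 1 / lam j) \<le> waterman_sum lam (card J)"
  using assms(2,3)
proof (induction J rule: finite_linorder_max_induct)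
  case empty
  then show ?case by (simp add: waterman_sum_def)
next
  case (insert b A)
  have "insert b A \<subseteq> {1..b}"
    using insert.hyps insert.prems by (force simp: Suc_le_eq intro: gr0I)
  then have "card (insert b A) \<le> card {1..b}" by (intro card_mono) auto
  moreover have card: "card (insert b A) = Suc (card A)"
    using insert.hyps by (subst card_insert_disjoint) auto
  ultimately have "1 / lam b \<le> 1 / lam (Suc (card A))"
    by (intro waterman_seq_reciprocal_antimono[OF lam]) auto
  moreover have "(\<Sum>j\<in>insert b A. 1 / lam j) = 1 / lam b + (\<Sum>j\<in>A. 1 / lam j)"
    using insert.hyps by (intro sum.insert) auto
  ultimately show ?case
    using insert.IH insert.prems unfolding card by (simp add: waterman_sum_def)
qed

text \<open>The partial sums form a concave sequence, so their averages decrease.\<close>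

lemma waterman_sum_ratio:
  assumes lam: "waterman_seq lam" and k: "1 \<le> k" "k \<le> j"
  shows "real k * waterman_sum lam j \<le> real j * waterman_sum lam k"
  using k(2)
proof (induction j rule: dec_induct)
  case base
  then show ?case by simp
next
  case (step j)
  \<comment> \<open>The new term is at most the mean of the first \<open>k\<close> terms.\<close>
  have "real k * (1 / lam (Suc j)) = (\<Sum>i=1..k. 1 / lam (Suc j))" by simp
  also have "\<dots> \<le> waterman_sum lam k"
    unfolding waterman_sum_def using step
    by (intro sum_mono waterman_seq_reciprocal_antimono[OF lam]) auto
  finally have "real k * (1 / lam (Suc j)) \<le> waterman_sum lam k" .
  moreover have "waterman_sum lam (Suc j) = waterman_sum lam j + 1 / lam (Suc j)"
    by (simp add: waterman_sum_def)
  ultimately show ?case using step.IH by (simp add: algebra_simps)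
qed

text \<open>Abel summation turns a sum over the terms of a decreasing sequence into a sum over its drops,
  each weighted by a full partial sum of the weights.\<close>

lemma sum_by_parts:
  fixes X w :: "nat \<Rightarrow> real"
  shows "(\<Sum>k=1..s. X k * w k) =
    (\<Sum>k=1..s. (X k - X (Suc k)) * (\<Sum>j=1..k. w j)) + X (Suc s) * (\<Sum>j=1..s. w j)"
  by (induction s) (auto simp: algebra_simps)

section \<open>The extremal inequality for decreasing sequences\<close>

text \<open>This is the heart of the sufficiency proof. The pointwise bound \<open>u k \<le> k powr (-1/q)\<close>, which is
  all that a single partial sum of the constraint gives, would lose a logarithm of \<open>s\<close>. Instead both
  sums are written by parts and compared drop by drop: at a drop from \<open>b\<close> to \<open>r * b\<close> with
  \<open>0 \<le> r \<le> 1\<close>,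
  \<open>b powr q - (r * b) powr q \<le> q * (1 - r) * b powr q\<close> and
  \<open>\<Phi> b - \<Phi> (r * b) \<ge> (1 - r) * \<Phi> b\<close>,
  so it remains to see that \<open>k * b powr q \<le> 2 * \<Phi> b * waterman_sum lam k\<close>. The hypothesis on \<open>\<Phi>\<close>
  yields this at the scale \<open>j \<approx> b powr (-q)\<close>, provided that \<open>j \<le> s\<close>; this is why the terms below
  \<open>s powr (-1/q)\<close> are split off. Together they contribute at most 1.\<close>

lemma powr_sum_le_of_weighted_gauge_sum_le:
  fixes \<Phi> :: "real \<Rightarrow> real" and u lam :: "nat \<Rightarrow> real"
  assumes mono: "strict_mono_on {0..} \<Phi>" and conv: "convex_on {0..} \<Phi>" and zero: "\<Phi> 0 = 0"
    and lam: "waterman_seq lam" and q: "1 \<le> q"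
    and u: "\<And>i. i \<in> {1..s} \<Longrightarrow> 0 \<le> u i"
    and decr: "\<And>i j. 1 \<le> i \<Longrightarrow> i \<le> j \<Longrightarrow> j \<le> s \<Longrightarrow> u j \<le> u i"
    and sum: "(\<Sum>i=1..s. \<Phi> (u i) / lam i) \<le> 1"
    and dom: "\<And>k. 1 \<le> k \<Longrightarrow> k \<le> s \<Longrightarrow> inverse (waterman_sum lam k) \<le> \<Phi> (real k powr (-1/q))"
  shows "(\<Sum>i=1..s. u i powr q) \<le> 3 powr q"
proof -
  let ?L = "waterman_sum lam"
  define thr where "thr = real s powr (-1/q)"
  \<comment> \<open>Setting \<open>x\<close> to 0 beyond \<open>s\<close> removes the boundary terms of both summations by parts.\<close>
  define x where "x k = (if k \<le> s \<and> thr \<le> u k then u k else 0)" for k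
  have x0: "0 \<le> x k" if "1 \<le> k" for k using u that by (auto simp: x_def)
  have xdecr: "x j \<le> x i" if "1 \<le> i" "i \<le> j" for i j
    using that decr[of i j] u[of i] by (auto simp: x_def)
  have leD: "\<Phi> a \<le> \<Phi> b" if "0 \<le> a" "a \<le> b" for a b
    using strict_mono_on_leD[OF mono, of a b] that by simp
  have \<Phi>0: "0 \<le> \<Phi> a" if "0 \<le> a" for a using gauge_nonneg[OF mono zero that] .
  have xsum: "(\<Sum>i=1..k. \<Phi> (x i) / lam i) \<le> 1" if "k \<le> s" for k
  proof -
    have "(\<Sum>i=1..k. \<Phi> (x i) / lam i) \<le> (\<Sum>i=1..s. \<Phi> (x i) / lam i)"
      using that x0 waterman_seq_pos[OF lam]
      by (intro sum_mono2) (auto intro!: divide_nonneg_pos \<Phi>0)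
    also have "\<dots> \<le> (\<Sum>i=1..s. \<Phi> (u i) / lam i)"
      using u waterman_seq_pos[OF lam]
      by (intro sum_mono divide_right_mono leD) (auto simp: x_def less_imp_le)
    finally show ?thesis using sum by simp
  qed
  have step: "(x k powr q - x (Suc k) powr q) * real k \<le> 2 * q * ((\<Phi> (x k) - \<Phi> (x (Suc k))) * ?L k)"
    if k: "1 \<le> k" "k \<le> s" for k
  proof (cases "x k = 0")
    case True
    then have "x (Suc k) = 0" using xdecr[of k "Suc k"] x0[of "Suc k"] k by simp
    then show ?thesis using True by simp
  next
    case False
    define b where "b = x k"
    define r where "r = x (Suc k) / b"
    have Lk: "0 < ?L k" by (rule waterman_sum_pos[OF lam k(1)])
    have thr: "thr \<le> b" "0 < thr" using False k by (auto simp: b_def x_def thr_def split: if_splits)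
    then have b: "0 < b" by simp
    have r: "0 \<le> r" "r \<le> 1" and xr: "x (Suc k) = r * b"
      using xdecr[of k "Suc k"] x0[of "Suc k"] k b by (auto simp: r_def b_def field_simps)
    \<comment> \<open>The first \<open>k\<close> terms are at least \<open>b\<close>, so the constraint bounds \<open>b\<close> from above.\<close>
    have "\<Phi> b * ?L k = (\<Sum>i=1..k. \<Phi> b / lam i)"
      by (simp add: waterman_sum_def sum_distrib_left)
    also have "\<dots> \<le> (\<Sum>i=1..k. \<Phi> (x i) / lam i)"
      using xdecr b waterman_seq_pos[OF lam]
      by (intro sum_mono divide_right_mono leD) (auto simp: b_def less_imp_le)
    also have "\<dots> \<le> 1" using xsum k by simp
    finally have "\<Phi> b \<le> inverse (?L k)" using Lk by (simp add: field_simps)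
    also have "\<dots> \<le> \<Phi> (real k powr (-1/q))" using dom k by simp
    finally have "b \<le> real k powr (-1/q)"
      using strict_mono_onD[OF mono, of "real k powr (-1/q)" b] b by force
    then have "(real k powr (-1/q)) powr (-q) \<le> b powr (-q)"
      using b q by (intro powr_mono2') auto
    then have kb: "real k \<le> b powr (-q)" using q k by (simp add: powr_powr)
    \<comment> \<open>At the scale \<open>j \<approx> b powr (-q)\<close>, which lies between \<open>k\<close> and \<open>s\<close>, the hypothesis bounds
      \<open>\<Phi> b\<close> from below, and the concavity of the partial sums transfers this bound to \<open>k\<close>.\<close>
    define j where "j = nat \<lceil>b powr (-q)\<rceil>"
    have bj: "b powr (-q) \<le> real j" by (simp add: j_def)
    have jb: "real j < b powr (-q) + 1"
      using ceiling_correct[of "b powr (-q)"] by (simp add: j_def)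
    have kj: "k \<le> j" using kb bj by simp
    have "b powr (-q) \<le> thr powr (-q)" using thr q by (intro powr_mono2') auto
    also have "\<dots> = real s" using q k by (simp add: thr_def powr_powr)
    finally have js: "j \<le> s" by (simp add: j_def nat_le_iff ceiling_le_iff)
    have j1: "1 \<le> j" using kj k by simp
    have "real j powr (-1/q) \<le> (b powr (-q)) powr (-1/q)"
      using bj b q by (intro powr_mono2') auto
    also have "\<dots> = b" using b q by (simp add: powr_powr)
    finally have "inverse (?L j) \<le> \<Phi> b"
      using dom[OF j1 js] leD[of "real j powr (-1/q)" b] by simp
    then have 1: "1 \<le> \<Phi> b * ?L j"
      using waterman_sum_pos[OF lam j1] by (simp add: field_simps)
    have "real k \<le> real k * (\<Phi> b * ?L j)" using 1 by (simp add: mult_le_cancel_left1)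
    also have "\<dots> = \<Phi> b * (real k * ?L j)" by simp
    also have "\<dots> \<le> \<Phi> b * (real j * ?L k)"
      using waterman_sum_ratio[OF lam k(1) kj] \<Phi>0 b by (intro mult_left_mono) auto
    also have "\<dots> \<le> \<Phi> b * ((2 * b powr (-q)) * ?L k)"
      using jb kb k \<Phi>0 b Lk by (intro mult_left_mono mult_right_mono) auto
    finally have "b powr q * real k \<le> b powr q * (\<Phi> b * ((2 * b powr (-q)) * ?L k))"
      by (intro mult_left_mono) auto
    also have "\<dots> = 2 * (\<Phi> b * ?L k)"
      using b by (simp add: powr_minus field_simps)
    finally have main: "b powr q * real k \<le> 2 * (\<Phi> b * ?L k)" .
    have "(x k powr q - x (Suc k) powr q) * real k = (1 - r powr q) * (b powr q * real k)"
      using r b by (simp add: xr powr_mult b_def[symmetric] algebra_simps)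
    also have "\<dots> \<le> (q * (1 - r)) * (b powr q * real k)"
      using powr_above_tangent[OF q r(1)] by (intro mult_right_mono) (auto simp: algebra_simps)
    also have "\<dots> \<le> (q * (1 - r)) * (2 * (\<Phi> b * ?L k))"
      using main q r by (intro mult_left_mono) auto
    also have "\<dots> = 2 * q * ((\<Phi> b - r * \<Phi> b) * ?L k)" by (simp add: algebra_simps)
    also have "\<dots> \<le> 2 * q * ((\<Phi> b - \<Phi> (r * b)) * ?L k)"
      using convex_at_zero_star_shaped[OF conv zero r, of b] b q Lk
      by (intro mult_left_mono mult_right_mono) auto
    finally show ?thesis by (simp add: b_def xr[unfolded b_def])
  qed
  have "(\<Sum>k=1..s. x k powr q) = (\<Sum>k=1..s. (x k powr q - x (Suc k) powr q) * real k)"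
    using sum_by_parts[of "\<lambda>k. x k powr q" "\<lambda>_. 1" s] by (simp add: x_def)
  also have "\<dots> \<le> (\<Sum>k=1..s. 2 * q * ((\<Phi> (x k) - \<Phi> (x (Suc k))) * ?L k))"
    using step by (intro sum_mono) auto
  also have "\<dots> = 2 * q * (\<Sum>k=1..s. \<Phi> (x k) / lam k)"
    using sum_by_parts[of "\<lambda>k. \<Phi> (x k)" "\<lambda>k. 1 / lam k" s]
    by (simp add: x_def zero sum_distrib_left waterman_sum_def)
  also have "\<dots> \<le> 2 * q" using xsum[of s] q by (simp add: mult_le_cancel_left1 mult.commute mult_left_le)
  finally have large: "(\<Sum>k=1..s. x k powr q) \<le> 2 * q" .
  \<comment> \<open>Each term below the threshold contributes at most \<open>1 / s\<close>.\<close>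
  have "(\<Sum>i=1..s. u i powr q) \<le> (\<Sum>i=1..s. x i powr q + 1 / real s)"
  proof (rule sum_mono)
    fix i assume i: "i \<in> {1..s}"
    show "u i powr q \<le> x i powr q + 1 / real s"
    proof (cases "thr \<le> u i")
      case False
      then have "u i powr q \<le> thr powr q" using u[OF i] q by (intro powr_mono2) auto
      also have "\<dots> = 1 / real s" using q i unfolding thr_def powr_powr by (simp add: powr_minus_divide)
      finally show ?thesis by (simp add: add_increasing)
    qed (use i in \<open>simp add: x_def\<close>)
  qed
  also have "\<dots> \<le> 2 * q + 1" using large q by (simp add: sum.distrib)
  also have "\<dots> \<le> 3 powr q" using powr_above_tangent[OF q, of 3] by simp
  finally show ?thesis .
qed

section \<open>Nonoverlapping intervals\<close>

text \<open>An interval contains every point strictly between its endpoints, so nonoverlapping members of a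
  collection have disjoint open intervals between their endpoints.\<close>

lemma nonoverlapping_intervalsD:
  assumes "nonoverlapping_intervals s I" "j \<in> {1..s}"
  shows "{Inf (I j)<..<Sup (I j)} \<subseteq> interior (I j)"
    and "0 \<le> Inf (I j)" "Inf (I j) \<le> Sup (I j)" "Sup (I j) \<le> 1"
proof -
  have I: "is_interval (I j)" "I j \<noteq> {}" "I j \<subseteq> {0..1}"
    using assms by (auto simp: nonoverlapping_intervals_def)
  have bdd: "bdd_above (I j)" "bdd_below (I j)"
    using I(3) by (meson bdd_above_Icc bdd_above_mono bdd_below_Icc bdd_below_mono)+
  have "x \<in> I j" if x: "Inf (I j) < x" "x < Sup (I j)" for x
  proof -
    obtain a where a: "a \<in> I j" "a < x" using x(1) cInf_less_iff[OF I(2) bdd(2)] by auto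
    obtain b where b: "b \<in> I j" "x < b" using x(2) less_cSup_iff[OF I(2) bdd(1)] by auto
    show ?thesis using I(1) a b unfolding is_interval_1 by (meson less_imp_le)
  qed
  then show "{Inf (I j)<..<Sup (I j)} \<subseteq> interior (I j)" by (intro interior_maximal) auto
  show "0 \<le> Inf (I j)" using I by (intro cInf_greatest) auto
  show "Sup (I j) \<le> 1" using I by (intro cSup_least) auto
  obtain x where "x \<in> I j" using I(2) by auto
  then show "Inf (I j) \<le> Sup (I j)"
    using cInf_lower[OF _ bdd(2)] cSup_upper[OF _ bdd(1)] by (meson order_trans)
qed

lemma nonoverlapping_intervals_disjoint:
  assumes I: "nonoverlapping_intervals s I" and ij: "i \<in> {1..s}" "j \<in> {1..s}" "i \<noteq> j"
  shows "{Inf (I i)<..<Sup (I i)} \<inter> {Inf (I j)<..<Sup (I j)} = {}"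
proof -
  have "interior (I i) \<inter> interior (I j) = {}"
    using I ij by (auto simp: nonoverlapping_intervals_def)
  then show ?thesis
    using nonoverlapping_intervalsD(1)[OF I ij(1)] nonoverlapping_intervalsD(1)[OF I ij(2)] by blast
qed

lemma sum_len_le_1:
  assumes I: "nonoverlapping_intervals s I"
  shows "(\<Sum>j=1..s. len (I j)) \<le> 1"
proof -
  note D = nonoverlapping_intervalsD[OF I]
  have "(\<Sum>j\<in>{1..s}. len (I j)) = (\<Sum>j\<in>{1..s}. measure lborel {Inf (I j)<..<Sup (I j)})"
    using D(3) by (intro sum.cong) (auto simp: len_def)
  also have "\<dots> = measure lborel (\<Union>j\<in>{1..s}. {Inf (I j)<..<Sup (I j)})"
  proof (rule measure_finite_Union[symmetric])
    show "disjoint_family_on (\<lambda>j. {Inf (I j)<..<Sup (I j)}) {1..s}"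
      using nonoverlapping_intervals_disjoint[OF I] by (auto simp: disjoint_family_on_def)
    show "emeasure lborel {Inf (I j)<..<Sup (I j)} \<noteq> \<infinity>" if "j \<in> {1..s}" for j
      using D(3)[OF that] by simp
  qed auto
  also have "\<dots> \<le> measure lborel {0..1::real}"
    using D(2,4) by (intro measure_mono_fmeasurable) (force simp: fmeasurable_def)+
  finally show ?thesis by simp
qed

lemma nonoverlapping_intervals_permute:
  assumes I: "nonoverlapping_intervals s I" and p: "bij_betw p {1..s} {1..s}"
  shows "nonoverlapping_intervals s (\<lambda>j. I (p j))"
  unfolding nonoverlapping_intervals_def
proof (intro conjI ballI impI)
  fix i j assume ij: "i \<in> {1..s}" "j \<in> {1..s}" "i \<noteq> j"
  then have "p i \<noteq> p j" using inj_onD[OF bij_betw_imp_inj_on[OF p]] by blast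
  then show "interior (I (p i)) \<inter> interior (I (p j)) = {}"
    using I bij_betw_apply[OF p ij(1)] bij_betw_apply[OF p ij(2)]
    unfolding nonoverlapping_intervals_def by blast
next
  fix j assume "j \<in> {1..s}"
  then have "p j \<in> {1..s}" by (rule bij_betw_apply[OF p])
  then show "is_interval (I (p j))" "I (p j) \<noteq> {}" "I (p j) \<subseteq> {0..1}"
    using I unfolding nonoverlapping_intervals_def by blast+
qed

text \<open>Since the collections are ordered arbitrarily, the gauge sum is bounded for every order of the
  increments, in particular for the decreasing one, to which the extremal inequality applies.\<close>

lemma ex_decreasing_rearrangement:
  fixes x :: "nat \<Rightarrow> real"
  obtains p where "bij_betw p {1..s} {1..s}"
    "\<And>i j. 1 \<le> i \<Longrightarrow> i \<le> j \<Longrightarrow> j \<le> s \<Longrightarrow> x (p j) \<le> x (p i)"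
proof -
  define xs where "xs = sort_key (\<lambda>j. - x j) [1..<Suc s]"
  have len: "length xs = s" and "set xs = {1..s}" "distinct xs"
    by (auto simp: xs_def)
  then have "bij_betw ((!) xs) {..<s} {1..s}" by (intro bij_betw_nth) auto
  moreover have "bij_betw (\<lambda>j. j - 1) {1..s} {..<s}"
    by (intro bij_betwI[where g = Suc]) auto
  ultimately have "bij_betw (\<lambda>j. xs ! (j - 1)) {1..s} {1..s}"
    using bij_betw_trans by (fastforce simp: o_def)
  moreover have "x (xs ! (j - 1)) \<le> x (xs ! (i - 1))" if "1 \<le> i" "i \<le> j" "j \<le> s" for i j
  proof -
    have "sorted (map (\<lambda>j. - x j) xs)" by (simp add: xs_def)
    then show ?thesis
      using sorted_nth_mono[of "map (\<lambda>j. - x j) xs" "i - 1" "j - 1"] that len by simp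
  qed
  ultimately show ?thesis by (rule that)
qed

section \<open>The two function classes and the limsup condition as uniform bounds\<close>

lemma phi_Lambda_BV_iff:
  "f \<in> phi_Lambda_BV \<phi> lam \<longleftrightarrow> (\<exists>c>0. \<exists>M. \<forall>s I. nonoverlapping_intervals s I \<longrightarrow>
     (\<Sum>j=1..s. \<phi> (c * \<bar>increment f (I j)\<bar>) / lam j) \<le> M)" (is "?L \<longleftrightarrow> ?R")
proof
  assume ?L
  then obtain c where c: "c > 0" and
    *: "(SUP (s, I) \<in> {(s, I). nonoverlapping_intervals s I}.
        ereal (\<Sum>j=1..s. \<phi> (c * \<bar>increment f (I j)\<bar>) / lam j)) < \<infinity>"
    unfolding phi_Lambda_BV_def by blast
  obtain M :: nat where M: "(SUP (s, I) \<in> {(s, I). nonoverlapping_intervals s I}.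
        ereal (\<Sum>j=1..s. \<phi> (c * \<bar>increment f (I j)\<bar>) / lam j)) < ereal (real M)"
    using less_PInf_Ex_of_nat[THEN iffD1, OF less_imp_neq[OF *]] by auto
  have "(\<Sum>j=1..s. \<phi> (c * \<bar>increment f (I j)\<bar>) / lam j) \<le> real M"
    if "nonoverlapping_intervals s I" for s I
    using SUP_upper[of "(s, I)" "{(s, I). nonoverlapping_intervals s I}"
        "\<lambda>(s, I). ereal (\<Sum>j=1..s. \<phi> (c * \<bar>increment f (I j)\<bar>) / lam j)"] M that
    by (auto dest: order.strict_trans1)
  then show ?R using c by blast
next
  assume ?R
  then obtain c M where c: "c > 0" and M: "\<And>s I. nonoverlapping_intervals s I \<Longrightarrow>
     (\<Sum>j=1..s. \<phi> (c * \<bar>increment f (I j)\<bar>) / lam j) \<le> M" by blast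
  have "(SUP (s, I) \<in> {(s, I). nonoverlapping_intervals s I}.
        ereal (\<Sum>j=1..s. \<phi> (c * \<bar>increment f (I j)\<bar>) / lam j)) \<le> ereal M"
    using M by (intro SUP_least) auto
  also have "\<dots> < \<infinity>" by simp
  finally show ?L using c unfolding phi_Lambda_BV_def by blast
qed

lemma BV_seq_iff:
  "f \<in> BV_seq qs \<delta> \<longleftrightarrow> (\<exists>M. \<forall>n\<ge>1. \<forall>s I. nonoverlapping_intervals s I \<longrightarrow>
     (\<forall>j\<in>{1..s}. len (I j) \<ge> 1 / \<delta> n) \<longrightarrow>
     (\<Sum>j=1..s. \<bar>increment f (I j)\<bar> powr qs n) powr (1 / qs n) \<le> M)" (is "?L \<longleftrightarrow> ?R")
proof -
  define S where "S n = {(s, I). nonoverlapping_intervals s I \<and> (\<forall>j\<in>{1..s}. len (I j) \<ge> 1 / \<delta> n)}"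
    for n
  define V where "V n = (\<lambda>(s::nat, I).
    ereal ((\<Sum>j=1..s. \<bar>increment f (I j)\<bar> powr qs n) powr (1 / qs n)))" for n
  have L: "?L \<longleftrightarrow> (SUP n\<in>{1..}. SUP J \<in> S n. V n J) < \<infinity>"
    by (simp add: BV_seq_def S_def V_def)
  have R: "?R \<longleftrightarrow> (\<exists>M. \<forall>n\<ge>1. \<forall>J\<in>S n. V n J \<le> ereal M)"
    unfolding S_def V_def by (simp add: split_paired_All Ball_def[of "Collect _"] imp_conjL)
  show ?thesis unfolding L R
  proof
    assume "(SUP n\<in>{1..}. SUP J \<in> S n. V n J) < \<infinity>"
    then obtain M :: nat where M: "(SUP n\<in>{1..}. SUP J \<in> S n. V n J) < ereal (real M)"
      using less_PInf_Ex_of_nat[THEN iffD1, OF less_imp_neq] by auto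
    have "V n J \<le> ereal (real M)" if "n \<ge> 1" "J \<in> S n" for n J
    proof -
      have "V n J \<le> (SUP J \<in> S n. V n J)" using that by (intro SUP_upper)
      also have "\<dots> \<le> (SUP n\<in>{1..}. SUP J \<in> S n. V n J)" using that by (intro SUP_upper) auto
      finally show ?thesis using M by simp
    qed
    then show "\<exists>M. \<forall>n\<ge>1. \<forall>J\<in>S n. V n J \<le> ereal M" by blast
  next
    assume "\<exists>M. \<forall>n\<ge>1. \<forall>J\<in>S n. V n J \<le> ereal M"
    then obtain M where "\<And>n J. n \<ge> 1 \<Longrightarrow> J \<in> S n \<Longrightarrow> V n J \<le> ereal M" by blast
    then have "(SUP n\<in>{1..}. SUP J \<in> S n. V n J) \<le> ereal M" by (intro SUP_least) auto
    also have "\<dots> < \<infinity>" by simp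
    finally show "(SUP n\<in>{1..}. SUP J \<in> S n. V n J) < \<infinity>" .
  qed
qed

text \<open>For a sequence of real numbers the finitely many terms before the eventual bound are
  harmless, so a finite upper limit already bounds the whole sequence.\<close>

lemma limsup_ereal_less_PInf_iff:
  fixes b :: "nat \<Rightarrow> real"
  shows "limsup (\<lambda>n. ereal (b n)) < \<infinity> \<longleftrightarrow> (\<exists>K. \<forall>n\<ge>1. b n \<le> K)"
proof
  assume "limsup (\<lambda>n. ereal (b n)) < \<infinity>"
  then obtain N :: nat where "limsup (\<lambda>n. ereal (b n)) < ereal (real N)"
    using less_PInf_Ex_of_nat[THEN iffD1, OF less_imp_neq] by auto
  then have "\<forall>\<^sub>F n in sequentially. ereal (b n) < ereal (real N)" by (rule Limsup_lessD)
  then obtain m where m: "\<And>n. n \<ge> m \<Longrightarrow> b n < real N" by (auto simp: eventually_sequentially)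
  have "b n \<le> max (real N) (Max (b ` {..m}))" for n
  proof (cases "n \<ge> m")
    case True
    then show ?thesis using m[of n] by simp
  next
    case False
    then have "b n \<le> Max (b ` {..m})" by (intro Max_ge) auto
    then show ?thesis by simp
  qed
  then show "\<exists>K. \<forall>n\<ge>1. b n \<le> K" by blast
next
  assume "\<exists>K. \<forall>n\<ge>1. b n \<le> K"
  then obtain K where "\<And>n. n \<ge> 1 \<Longrightarrow> b n \<le> K" by blast
  then have "limsup (\<lambda>n. ereal (b n)) \<le> ereal K"
    by (intro Limsup_bounded) (auto simp: eventually_sequentially intro!: exI[of _ 1])
  also have "\<dots> < \<infinity>" by simp
  finally show "limsup (\<lambda>n. ereal (b n)) < \<infinity>" .
qed

section \<open>Sufficiency of the growth condition\<close>

text \<open>The lengths of the intervals sum to at most 1, so there are at most \<open>d\<close> of them, and the growth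
  bound is available at every index that the extremal inequality needs. That inequality is applied
  to \<open>\<Phi> t = \<phi> (B * t)\<close> and to the increments in decreasing order, scaled so that their gauge sum
  is at most 1.\<close>

lemma powr_variation_le:
  fixes \<phi> :: "real \<Rightarrow> real" and lam :: "nat \<Rightarrow> real"
  assumes mono: "strict_mono_on {0..} \<phi>" and conv: "convex_on {0..} \<phi>" and zero: "\<phi> 0 = 0"
    and lam: "waterman_seq lam" and q: "1 \<le> q" and d: "0 < d"
    and c: "0 < c" and M: "1 \<le> M" and f: "\<And>s I. nonoverlapping_intervals s I \<Longrightarrow>
      (\<Sum>j=1..s. \<phi> (c * \<bar>increment f (I j)\<bar>) / lam j) \<le> M"
    and B: "0 < B" "\<And>k. 1 \<le> k \<Longrightarrow> real k \<le> d \<Longrightarrow>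
      real k powr (1/q) * the_inv_into {0..} \<phi> (inverse (waterman_sum lam k)) \<le> B"
    and I: "nonoverlapping_intervals s I" and len: "\<And>j. j \<in> {1..s} \<Longrightarrow> len (I j) \<ge> 1 / d"
  shows "(\<Sum>j=1..s. \<bar>increment f (I j)\<bar> powr q) powr (1/q) \<le> 3 * B * M / c"
proof -
  have "real s * (1 / d) = (\<Sum>j=1..s. 1 / d)" by simp
  also have "\<dots> \<le> (\<Sum>j=1..s. len (I j))" using len by (intro sum_mono) auto
  also have "\<dots> \<le> 1" by (rule sum_len_le_1[OF I])
  finally have sd: "real s \<le> d" using d by (simp add: field_simps)
  obtain p where p: "bij_betw p {1..s} {1..s}" and
    decr: "\<And>i j. 1 \<le> i \<Longrightarrow> i \<le> j \<Longrightarrow> j \<le> s \<Longrightarrow> \<bar>increment f (I (p j))\<bar> \<le> \<bar>increment f (I (p i))\<bar>"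
    using ex_decreasing_rearrangement[of s "\<lambda>j. \<bar>increment f (I j)\<bar>"] by blast
  define u where "u j = c / (B * M) * \<bar>increment f (I (p j))\<bar>" for j
  have "(\<Sum>j=1..s. u j powr q) \<le> 3 powr q"
  proof (rule powr_sum_le_of_weighted_gauge_sum_le[OF _ _ _ lam q, where \<Phi> = "\<lambda>t. \<phi> (B * t)"])
    show "strict_mono_on {0..} (\<lambda>t. \<phi> (B * t))"
      using mono B(1) by (auto simp: strict_mono_on_def)
    show "convex_on {0..} (\<lambda>t. \<phi> (B * t))"
    proof (rule convex_onI)
      fix t x y :: real assume "0 < t" "t < 1" "x \<in> {0..}" "y \<in> {0..}"
      then show "\<phi> (B * ((1 - t) *\<^sub>R x + t *\<^sub>R y)) \<le> (1 - t) * \<phi> (B * x) + t * \<phi> (B * y)"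
        using convex_onD[OF conv, of t "B * x" "B * y"] B(1) by (simp add: algebra_simps)
    qed simp
    show "\<phi> (B * 0) = 0" using zero by simp
    show "0 \<le> u j" for j using B c M by (simp add: u_def)
    show "u j \<le> u i" if "1 \<le> i" "i \<le> j" "j \<le> s" for i j
      unfolding u_def using decr[OF that] B c M by (intro mult_left_mono) auto
    \<comment> \<open>Dividing the argument by \<open>M \<ge> 1\<close> divides the values at least by \<open>M\<close>.\<close>
    have "\<phi> (B * u j) \<le> (1 / M) * \<phi> (c * \<bar>increment f (I (p j))\<bar>)" for j
      using convex_at_zero_star_shaped[OF conv zero, of "1 / M" "c * \<bar>increment f (I (p j))\<bar>"]
        B c M by (simp add: u_def)
    then have "(\<Sum>j=1..s. \<phi> (B * u j) / lam j) \<le>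
        (\<Sum>j=1..s. (1 / M) * \<phi> (c * \<bar>increment f (I (p j))\<bar>) / lam j)"
      using waterman_seq_pos[OF lam] by (intro sum_mono divide_right_mono) (auto intro: less_imp_le)
    also have "\<dots> = (1 / M) * (\<Sum>j=1..s. \<phi> (c * \<bar>increment f (I (p j))\<bar>) / lam j)"
      by (simp add: sum_distrib_left)
    also have "\<dots> \<le> (1 / M) * M"
      using f[OF nonoverlapping_intervals_permute[OF I p]] M by (intro mult_left_mono) auto
    finally show "(\<Sum>j=1..s. \<phi> (B * u j) / lam j) \<le> 1" using M by simp
    fix k assume k: "1 \<le> k" "k \<le> s"
    define v where "v = the_inv_into {0..} \<phi> (inverse (waterman_sum lam k))"
    have v: "0 \<le> v" "\<phi> v = inverse (waterman_sum lam k)"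
      using gauge_inverse[OF mono conv zero, of "inverse (waterman_sum lam k)"]
        waterman_sum_pos[OF lam k(1)] by (auto simp: v_def)
    have "real k powr (1/q) * v \<le> B" using B(2)[of k] k sd by (simp add: v_def)
    then have "v \<le> B * real k powr (-1/q)"
      using k by (simp add: powr_minus field_simps)
    then show "inverse (waterman_sum lam k) \<le> \<phi> (B * real k powr (-1/q))"
      using strict_mono_on_leD[OF mono, of v] v by auto
  qed
  then have le: "(\<Sum>j=1..s. u j powr q) powr (1/q) \<le> (3 powr q) powr (1/q)"
    using q by (intro powr_mono2 sum_nonneg) auto
  define S where "S = (\<Sum>j=1..s. \<bar>increment f (I j)\<bar> powr q)"
  have "(\<Sum>j=1..s. u j powr q) = (c / (B * M)) powr q * (\<Sum>j=1..s. \<bar>increment f (I (p j))\<bar> powr q)"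
    unfolding u_def sum_distrib_left
    by (intro sum.cong refl powr_mult)
  also have "(\<Sum>j=1..s. \<bar>increment f (I (p j))\<bar> powr q) = S"
    unfolding S_def by (rule sum.reindex_bij_betw[OF p])
  finally have "c / (B * M) * S powr (1/q) \<le> 3"
    using le q B c M by (simp add: powr_mult powr_powr S_def sum_nonneg)
  then show ?thesis using B c M by (simp add: S_def field_simps)
qed

section \<open>Superpositions of spikes\<close>

text \<open>Two nondegenerate intervals that share a left endpoint, or a right endpoint, overlap.\<close>

lemma card_spike_intervals_le:
  assumes I: "nonoverlapping_intervals s I" and D: "finite D"
  shows "card {j\<in>{1..s}. Inf (I j) < Sup (I j) \<and> Inf (I j) \<in> D} \<le> card D"
    and "card {j\<in>{1..s}. Inf (I j) < Sup (I j) \<and> Sup (I j) \<in> D} \<le> card D"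
proof -
  have "i = j" if "i \<in> {1..s}" "j \<in> {1..s}" "Inf (I i) < Sup (I i)" "Inf (I j) < Sup (I j)"
    "Inf (I i) = Inf (I j) \<or> Sup (I i) = Sup (I j)" for i j
  proof (rule ccontr)
    assume "i \<noteq> j"
    then have disj: "{Inf (I i)<..<Sup (I i)} \<inter> {Inf (I j)<..<Sup (I j)} = {}"
      using nonoverlapping_intervals_disjoint[OF I] that by blast
    have "max (Inf (I i)) (Inf (I j)) < min (Sup (I i)) (Sup (I j))" using that by auto
    then obtain x where "max (Inf (I i)) (Inf (I j)) < x" "x < min (Sup (I i)) (Sup (I j))"
      using dense by blast
    then have "x \<in> {Inf (I i)<..<Sup (I i)} \<inter> {Inf (I j)<..<Sup (I j)}" by simp
    then show False using disj by blast
  qed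
  note eq = this
  show "card {j\<in>{1..s}. Inf (I j) < Sup (I j) \<and> Inf (I j) \<in> D} \<le> card D"
  proof (rule card_inj_on_le[OF _ _ D])
    show "inj_on (\<lambda>j. Inf (I j)) {j\<in>{1..s}. Inf (I j) < Sup (I j) \<and> Inf (I j) \<in> D}"
      by (rule inj_onI, rule eq) simp_all
  qed blast
  show "card {j\<in>{1..s}. Inf (I j) < Sup (I j) \<and> Sup (I j) \<in> D} \<le> card D"
  proof (rule card_inj_on_le[OF _ _ D])
    show "inj_on (\<lambda>j. Sup (I j)) {j\<in>{1..s}. Inf (I j) < Sup (I j) \<and> Sup (I j) \<in> D}"
      by (rule inj_onI, rule eq) simp_all
  qed blast
qed

text \<open>Only intervals with an endpoint in \<open>D\<close> see the spikes. Those with left endpoint in \<open>D\<close> number at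
  most \<open>card D\<close>, and so do those with right endpoint in \<open>D\<close>; either group contributes at most
  \<open>\<phi> v\<close> times a partial sum of the reciprocals.\<close>

lemma spike_gauge_sum_le:
  fixes \<phi> :: "real \<Rightarrow> real"
  assumes lam: "waterman_seq lam" and zero: "\<phi> 0 = 0"
    and v: "0 \<le> v" "0 \<le> \<phi> v" "\<phi> v * waterman_sum lam k \<le> 1"
    and D: "finite D" "card D \<le> k"
    and I: "nonoverlapping_intervals s I"
  shows "(\<Sum>j=1..s. \<phi> \<bar>increment (\<lambda>x. v * indicator D x) (I j)\<bar> / lam j) \<le> 2"
proof -
  define J1 where "J1 = {j\<in>{1..s}. Inf (I j) < Sup (I j) \<and> Inf (I j) \<in> D}"
  define J2 where "J2 = {j\<in>{1..s}. Inf (I j) < Sup (I j) \<and> Sup (I j) \<in> D}"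
  have bound: "\<phi> v * (\<Sum>j\<in>J. 1 / lam j) \<le> 1" if J: "J \<in> {J1, J2}" for J
  proof -
    have "finite J" "0 \<notin> J" "card J \<le> card D"
      using J card_spike_intervals_le[OF I D(1)] by (auto simp: J1_def J2_def)
    then have "(\<Sum>j\<in>J. 1 / lam j) \<le> waterman_sum lam (card J)"
      "waterman_sum lam (card J) \<le> waterman_sum lam k"
      using D(2) by (auto intro!: sum_reciprocal_le_waterman_sum[OF lam] waterman_sum_mono[OF lam])
    then have "\<phi> v * (\<Sum>j\<in>J. 1 / lam j) \<le> \<phi> v * waterman_sum lam k"
      using v(2) by (intro mult_left_mono) auto
    then show ?thesis using v(3) by simp
  qed
  have sub: "J1 \<subseteq> {1..s}" "J2 \<subseteq> {1..s}" by (auto simp: J1_def J2_def)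
  have "(\<Sum>j=1..s. \<phi> \<bar>increment (\<lambda>x. v * indicator D x) (I j)\<bar> / lam j) \<le>
    (\<Sum>j=1..s. (if j \<in> J1 then \<phi> v / lam j else 0) + (if j \<in> J2 then \<phi> v / lam j else 0))"
  proof (rule sum_mono)
    fix j assume j: "j \<in> {1..s}"
    have "0 \<le> \<phi> v / lam j" using v(2) waterman_seq_pos[OF lam, of j] j by simp
    then show "\<phi> \<bar>increment (\<lambda>x. v * indicator D x) (I j)\<bar> / lam j \<le>
        (if j \<in> J1 then \<phi> v / lam j else 0) + (if j \<in> J2 then \<phi> v / lam j else 0)"
      using j nonoverlapping_intervalsD(3)[OF I j] v(1) zero
      by (auto simp: J1_def J2_def increment_def indicator_def not_less)
  qed
  also have "\<dots> = \<phi> v * (\<Sum>j\<in>J1. 1 / lam j) + \<phi> v * (\<Sum>j\<in>J2. 1 / lam j)"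
    using sub by (simp add: sum.distrib sum.If_cases Int_absorb1 sum_distrib_left)
  also have "\<dots> \<le> 2" using bound[of J1] bound[of J2] by simp
  finally show ?thesis .
qed

text \<open>The weights sum to 1, so that the series is an infinite convex combination of spike functions,
  to which Jensen's inequality applies.\<close>

definition spike_series :: "(nat \<Rightarrow> real) \<Rightarrow> (nat \<Rightarrow> real set) \<Rightarrow> real \<Rightarrow> real" where
  "spike_series v D x = (\<Sum>i. (1/2) ^ Suc i * (v i * indicator (D i) x))"

lemma summable_half_powers_mult:
  fixes a :: "nat \<Rightarrow> real"
  assumes "\<And>i. \<bar>a i\<bar> \<le> C"
  shows "summable (\<lambda>i. (1/2) ^ Suc i * a i)"
proof (rule summable_comparison_test')
  show "summable (\<lambda>i. (1/2) ^ Suc i * C)" by (intro summable_mult2 sums_summable[OF power_half_series])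
  show "norm ((1/2) ^ Suc i * a i) \<le> (1/2) ^ Suc i * C" for i :: nat
    using assms[of i] by (simp add: abs_mult)
qed

lemma spike_series_ge:
  assumes v: "\<And>i. 0 \<le> v i" "\<And>i. v i \<le> C" and x: "x \<in> D i"
  shows "(1/2) ^ Suc i * v i \<le> spike_series v D x"
proof -
  have "summable (\<lambda>i. (1/2) ^ Suc i * (v i * indicator (D i) x))"
    using v order_trans[OF v] by (intro summable_half_powers_mult[where C = C]) (auto simp: indicator_def)
  from sum_le_suminf[OF this, of "{i}"] show ?thesis
    using v x unfolding spike_series_def by simp
qed

lemma spike_series_eq_0: "(\<And>i. x \<notin> D i) \<Longrightarrow> spike_series v D x = 0"
  by (simp add: spike_series_def)

text \<open>Because the weights sum to 1, Jensen's inequality bounds the gauge sum of the superposition by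
  the weighted average of the gauge sums of its layers, each of which is at most 2.\<close>

lemma spike_series_in_phi_Lambda_BV:
  fixes \<phi> :: "real \<Rightarrow> real" and lam :: "nat \<Rightarrow> real"
  assumes mono: "strict_mono_on {0..} \<phi>" and conv: "convex_on {0..} \<phi>" and zero: "\<phi> 0 = 0"
    and lam: "waterman_seq lam"
    and v: "\<And>i. 0 \<le> v i" "\<And>i. v i \<le> C" "\<And>i. \<phi> (v i) * waterman_sum lam (k i) \<le> 1"
    and D: "\<And>i. finite (D i)" "\<And>i. card (D i) \<le> k i"
  shows "spike_series v D \<in> phi_Lambda_BV \<phi> lam"
  unfolding phi_Lambda_BV_iff
proof (intro exI conjI allI impI)
  fix s I assume I: "nonoverlapping_intervals s I"
  let ?w = "\<lambda>i::nat. (1/2) ^ Suc i :: real"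
  define g where "g i = (\<lambda>x. v i * indicator (D i) x :: real)" for i
  define a where "a i j = \<bar>increment (g i) (I j)\<bar>" for i j
  have leD: "\<phi> x \<le> \<phi> y" if "0 \<le> x" "x \<le> y" for x y
    using strict_mono_on_leD[OF mono, of x y] that by simp
  have g: "0 \<le> g i x" "g i x \<le> C" for i x
    using v(1,2)[of i] order_trans[OF v(1) v(2)[of i]] by (auto simp: g_def indicator_def)
  have a: "0 \<le> a i j" "a i j \<le> C" for i j
    using g[of i "Sup (I j)"] g[of i "Inf (I j)"] by (auto simp: a_def increment_def)
  have sa: "summable (\<lambda>i. ?w i * a i j)" for j
    using a by (intro summable_half_powers_mult[where C = C]) auto
  have sfa: "summable (\<lambda>i. ?w i * \<phi> (a i j))" for j
    using a gauge_nonneg[OF mono zero] leD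
    by (intro summable_half_powers_mult[where C = "\<phi> C"]) auto
  have gauge_le: "\<phi> (1 * \<bar>increment (spike_series v D) (I j)\<bar>) \<le> (\<Sum>i. ?w i * \<phi> (a i j))" for j
  proof -
    have sg: "summable (\<lambda>i. ?w i * g i x)" for x
      using g by (intro summable_half_powers_mult[where C = C]) auto
    have "increment (spike_series v D) (I j) = (\<Sum>i. ?w i * increment (g i) (I j))"
      using suminf_diff[OF sg sg]
      by (simp add: increment_def spike_series_def g_def right_diff_distrib)
    also have "\<bar>\<dots>\<bar> \<le> (\<Sum>i. \<bar>?w i * increment (g i) (I j)\<bar>)"
      using sa[of j] by (intro summable_rabs) (simp add: a_def abs_mult)
    also have "\<dots> = (\<Sum>i. ?w i * a i j)" by (simp add: a_def abs_mult)
    finally have "\<phi> \<bar>increment (spike_series v D) (I j)\<bar> \<le> \<phi> (\<Sum>i. ?w i * a i j)"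
      by (intro leD) auto
    also have "\<dots> \<le> (\<Sum>i. ?w i * \<phi> (a i j))"
      using a sa sfa by (intro gauge_jensen_suminf[OF mono conv zero power_half_series]) auto
    finally show ?thesis by simp
  qed
  have "(\<Sum>j=1..s. \<phi> (1 * \<bar>increment (spike_series v D) (I j)\<bar>) / lam j) \<le>
      (\<Sum>j=1..s. (\<Sum>i. ?w i * \<phi> (a i j)) / lam j)"
    using waterman_seq_pos[OF lam]
    by (intro sum_mono divide_right_mono gauge_le) (auto intro: less_imp_le)
  also have "\<dots> = (\<Sum>j=1..s. \<Sum>i. ?w i * \<phi> (a i j) / lam j)"
    by (intro sum.cong refl suminf_divide[OF sfa, symmetric])
  also have "\<dots> = (\<Sum>i. \<Sum>j=1..s. ?w i * \<phi> (a i j) / lam j)"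
    by (intro suminf_sum[symmetric] summable_divide sfa)
  also have "\<dots> \<le> (\<Sum>i. ?w i * 2)"
  proof (rule suminf_le)
    show "summable (\<lambda>i. \<Sum>j=1..s. ?w i * \<phi> (a i j) / lam j)"
      by (intro summable_sum summable_divide sfa)
    show "summable (\<lambda>i. ?w i * 2)" by (intro summable_mult2 sums_summable[OF power_half_series])
    fix i
    have "(\<Sum>j=1..s. \<phi> (a i j) / lam j) \<le> 2"
      unfolding a_def g_def
      using v(1,3) gauge_nonneg[OF mono zero]
      by (intro spike_gauge_sum_le[where \<phi> = \<phi> and v = "v i" and D = "D i" and k = "k i"]
        lam zero D I) auto
    then have "?w i * (\<Sum>j=1..s. \<phi> (a i j) / lam j) \<le> ?w i * 2" by (intro mult_left_mono) auto
    then show "(\<Sum>j=1..s. ?w i * \<phi> (a i j) / lam j) \<le> ?w i * 2"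
      by (simp add: sum_distrib_left)
  qed
  also have "\<dots> = 2"
    using sums_unique[OF sums_mult2[OF power_half_series, of 2]] by simp
  finally show "(\<Sum>j=1..s. \<phi> (1 * \<bar>increment (spike_series v D) (I j)\<bar>) / lam j) \<le> 2" .
qed simp

section \<open>Necessity of the growth condition\<close>

lemma ex_irrational_between:
  fixes a b :: real
  assumes "a < b"
  obtains x where "a < x" "x < b" "x \<notin> \<rat>"
proof -
  have "\<not> {a<..<b} \<subseteq> \<rat>"
    using uncountable_open_interval[of a b] assms countable_subset[OF _ countable_rat] by blast
  then show ?thesis using that by (auto simp: subset_iff)
qed

text \<open>The spikes of \<open>f\<close> sit at rational points, whereas \<open>f\<close> vanishes at irrational ones. An interval
  from a spike to an irrational point therefore has an increment that no other part of \<open>f\<close> can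
  cancel. The strict inequality \<open>m < d\<close> leaves room to choose the right endpoint irrational and still
  keep the length at least \<open>1 / d\<close>.\<close>

lemma powr_variation_ge:
  fixes f :: "real \<Rightarrow> real"
  assumes m: "1 \<le> m" "real m < d" and q: "1 \<le> q" and h: "0 \<le> h"
    and spike: "\<And>i. i < m \<Longrightarrow> h \<le> f (real i / real m)"
    and irr: "\<And>x. x \<notin> \<rat> \<Longrightarrow> f x = 0"
  obtains I where "nonoverlapping_intervals m I" "\<forall>j\<in>{1..m}. len (I j) \<ge> 1 / d"
    "real m powr (1/q) * h \<le> (\<Sum>j=1..m. \<bar>increment f (I j)\<bar> powr q) powr (1/q)"
proof -
  have gap: "1 / d < 1 / real m" using m by (simp add: field_simps)
  have "\<exists>b. real i / real m + 1 / d < b \<and> b < real i / real m + 1 / real m \<and> b \<notin> \<rat>" for i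
    using ex_irrational_between[of "real i / real m + 1 / d" "real i / real m + 1 / real m"] gap
    by (metis add_strict_left_mono)
  then obtain b where b: "\<And>i::nat. real i / real m + 1 / d < b i"
    "\<And>i. b i < real i / real m + 1 / real m" "\<And>i. b i \<notin> \<rat>" by metis
  define I where "I j = {real (j - 1) / real m..b (j - 1)}" for j
  have d: "0 < 1 / d" using m by simp
  have lt: "real i / real m < b i" for i using b(1)[of i] d by linarith
  have ends: "Inf (I j) = real (j - 1) / real m" "Sup (I j) = b (j - 1)" for j
    using less_imp_le[OF lt[of "j - 1"]] by (simp_all add: I_def)
  have sep: "b i \<le> real j / real m" if "i < j" for i j
  proof -
    have "b i \<le> (real i + 1) / real m" using b(2)[of i] by (simp add: add_divide_distrib)
    also have "\<dots> \<le> real j / real m" using that by (intro divide_right_mono) auto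
    finally show ?thesis .
  qed
  have "nonoverlapping_intervals m I"
    unfolding nonoverlapping_intervals_def
  proof (intro conjI ballI impI)
    fix j assume j: "j \<in> {1..m}"
    show "is_interval (I j)" by (simp add: I_def is_interval_cc)
    show "I j \<noteq> {}" using less_imp_le[OF lt[of "j - 1"]] by (simp add: I_def)
    have "b (j - 1) \<le> real m / real m" by (rule sep) (use j m in auto)
    then show "I j \<subseteq> {0..1}" using m by (auto simp: I_def intro: order_trans[rotated])
  next
    fix i j assume "i \<in> {1..m}" "j \<in> {1..m}" "i \<noteq> j"
    then have "b (i - 1) \<le> real (j - 1) / real m \<or> b (j - 1) \<le> real (i - 1) / real m"
      using sep[of "i - 1" "j - 1"] sep[of "j - 1" "i - 1"] by fastforce
    then show "interior (I i) \<inter> interior (I j) = {}"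
      by (auto simp: I_def)
  qed
  moreover have "\<forall>j\<in>{1..m}. len (I j) \<ge> 1 / d"
  proof
    show "len (I j) \<ge> 1 / d" for j using b(1)[of "j - 1"] unfolding len_def ends by linarith
  qed
  moreover have "real m powr (1/q) * h \<le> (\<Sum>j=1..m. \<bar>increment f (I j)\<bar> powr q) powr (1/q)"
  proof -
    have "real m * h powr q = (\<Sum>j=1..m. h powr q)" by simp
    also have "\<dots> \<le> (\<Sum>j=1..m. \<bar>increment f (I j)\<bar> powr q)"
    proof (rule sum_mono)
      fix j assume j: "j \<in> {1..m}"
      then have "h \<le> \<bar>increment f (I j)\<bar>"
        using spike[of "j - 1"] irr[OF b(3)] m by (simp add: increment_def ends) linarith
      then show "h powr q \<le> \<bar>increment f (I j)\<bar> powr q" using h q by (intro powr_mono2) auto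
    qed
    finally have "(real m * h powr q) powr (1/q) \<le> (\<Sum>j=1..m. \<bar>increment f (I j)\<bar> powr q) powr (1/q)"
      using q by (intro powr_mono2) auto
    then show ?thesis using q h by (simp add: powr_mult powr_powr)
  qed
  ultimately show ?thesis by (rule that)
qed

text \<open>Layer \<open>i\<close> of the counterexample has about \<open>k / 2\<close> spikes of height \<open>v = \<phi>\<^sup>-\<^sup>1 (1 / \<Lambda>(k))\<close>, where
  \<open>k\<close> and \<open>n\<close> are such that \<open>k powr (1 / qs n) * v > 4 ^ i\<close>. The height is the largest for which
  \<open>k\<close> jumps have a gauge sum of at most 1. The weight \<open>(1/2) ^ Suc i\<close> of the layer leaves a variation
  with exponent \<open>qs n\<close> of order at least \<open>2 ^ i\<close>.\<close>

lemma ex_phi_Lambda_BV_not_BV_seq: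
  fixes \<phi> :: "real \<Rightarrow> real" and lam qs \<delta> :: "nat \<Rightarrow> real"
  assumes mono: "strict_mono_on {0..} \<phi>" and conv: "convex_on {0..} \<phi>" and zero: "\<phi> 0 = 0"
    and lam: "waterman_seq lam"
    and qs: "\<And>n. n \<ge> 1 \<Longrightarrow> 1 \<le> qs n" and \<delta>: "\<And>n. n \<ge> 1 \<Longrightarrow> 2 \<le> \<delta> n"
    and unbounded: "\<And>K. \<exists>n k. 1 \<le> n \<and> 1 \<le> k \<and> real k \<le> \<delta> n \<and>
      K < real k powr (1 / qs n) * the_inv_into {0..} \<phi> (inverse (waterman_sum lam k))"
  shows "\<exists>f. f \<in> phi_Lambda_BV \<phi> lam \<and> f \<notin> BV_seq qs \<delta>"
proof -
  define \<psi> where "\<psi> k = the_inv_into {0..} \<phi> (inverse (waterman_sum lam k))" for k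
  have "\<forall>i. \<exists>n k. 1 \<le> n \<and> 1 \<le> k \<and> real k \<le> \<delta> n \<and> 4 ^ i < real k powr (1 / qs n) * \<psi> k"
    using unbounded unfolding \<psi>_def by blast
  then obtain n k where n: "\<And>i. 1 \<le> n i" and k: "\<And>i. 1 \<le> k i" "\<And>i. real (k i) \<le> \<delta> (n i)"
    and large: "\<And>i. 4 ^ i < real (k i) powr (1 / qs (n i)) * \<psi> (k i)" by metis
  have \<psi>: "0 \<le> \<psi> j" "\<phi> (\<psi> j) = inverse (waterman_sum lam j)" if "1 \<le> j" for j
    using gauge_inverse[OF mono conv zero, of "inverse (waterman_sum lam j)"]
      waterman_sum_pos[OF lam that] by (auto simp: \<psi>_def)
  have \<psi>1: "\<psi> j \<le> \<psi> 1" if j: "1 \<le> j" for j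
  proof (rule ccontr)
    assume "\<not> \<psi> j \<le> \<psi> 1"
    then have "\<phi> (\<psi> 1) < \<phi> (\<psi> j)"
      using strict_mono_onD[OF mono, of "\<psi> 1" "\<psi> j"] \<psi>[of 1] \<psi>[OF j] by simp
    moreover have "inverse (waterman_sum lam j) \<le> inverse (waterman_sum lam 1)"
      using waterman_sum_mono[OF lam j] waterman_sum_pos[OF lam, of 1] by (intro le_imp_inverse_le) auto
    ultimately show False using \<psi>[of 1] \<psi>[OF j] by simp
  qed
  \<comment> \<open>Halving \<open>k i\<close> makes the number of spikes strictly smaller than \<open>\<delta> (n i)\<close>; for \<open>k i = 1\<close>, where
    rounding up keeps one spike, this holds because \<open>\<delta> (n i) \<ge> 2\<close>.\<close>
  define m where "m i = (k i + 1) div 2" for i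
  have m: "1 \<le> m i" "m i \<le> k i" "real (k i) \<le> 2 * real (m i)" "real (m i) < \<delta> (n i)" for i
  proof -
    show "1 \<le> m i" "m i \<le> k i" "real (k i) \<le> 2 * real (m i)"
      using k(1)[of i] by (auto simp: m_def)
    show "real (m i) < \<delta> (n i)"
    proof (cases "k i = 1")
      case True
      then show ?thesis using \<delta>[OF n[of i]] by (simp add: m_def)
    next
      case False
      then have "m i < k i" using k(1)[of i] by (auto simp: m_def)
      then show ?thesis using k(2)[of i] by linarith
    qed
  qed
  define v where "v i = \<psi> (k i)" for i
  define D where "D i = (\<lambda>l. real l / real (m i)) ` {..<m i}" for i
  define f where "f = spike_series v D"
  have v: "0 \<le> v i" "v i \<le> \<psi> 1" "\<phi> (v i) * waterman_sum lam (k i) \<le> 1" for i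
    using \<psi>[OF k(1)] \<psi>1[OF k(1)] waterman_sum_pos[OF lam k(1)[of i]] by (auto simp: v_def)
  have "card (D i) \<le> k i" for i
    using card_image_le[of "{..<m i}" "\<lambda>l. real l / real (m i)"] m(2)[of i] by (simp add: D_def)
  then have "f \<in> phi_Lambda_BV \<phi> lam"
    unfolding f_def by (intro spike_series_in_phi_Lambda_BV[OF mono conv zero lam v]) (auto simp: D_def)
  moreover have "f \<notin> BV_seq qs \<delta>"
  proof
    assume "f \<in> BV_seq qs \<delta>"
    then obtain M where M: "\<And>n s I. n \<ge> 1 \<Longrightarrow> nonoverlapping_intervals s I \<Longrightarrow>
       (\<forall>j\<in>{1..s}. len (I j) \<ge> 1 / \<delta> n) \<Longrightarrow>
       (\<Sum>j=1..s. \<bar>increment f (I j)\<bar> powr qs n) powr (1 / qs n) \<le> M"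
      unfolding BV_seq_iff by metis
    have "2 ^ i / 4 \<le> M" for i :: nat
    proof -
      let ?q = "qs (n i)"
      have q: "1 \<le> ?q" by (rule qs[OF n])
      have ge: "(1/2) ^ Suc i * v i \<le> f (real l / real (m i))" if "l < m i" for l
        unfolding f_def using that by (intro spike_series_ge[OF v(1,2)]) (auto simp: D_def)
      have irr: "f x = 0" if "x \<notin> \<rat>" for x
        unfolding f_def using that by (intro spike_series_eq_0) (auto simp: D_def)
      obtain I where I: "nonoverlapping_intervals (m i) I" "\<forall>j\<in>{1..m i}. len (I j) \<ge> 1 / \<delta> (n i)"
        "real (m i) powr (1 / ?q) * ((1/2) ^ Suc i * v i) \<le>
          (\<Sum>j=1..m i. \<bar>increment f (I j)\<bar> powr ?q) powr (1 / ?q)"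
        using powr_variation_ge[where f = f and m = "m i" and d = "\<delta> (n i)" and q = ?q
            and h = "(1/2) ^ Suc i * v i"] m(1,4) q v(1)[of i] ge irr by auto
      have "real (k i) powr (1 / ?q) \<le> (2 * real (m i)) powr (1 / ?q)"
        using m(3) q by (intro powr_mono2) auto
      also have "\<dots> = 2 powr (1 / ?q) * real (m i) powr (1 / ?q)" by (simp add: powr_mult)
      also have "\<dots> \<le> 2 powr 1 * real (m i) powr (1 / ?q)"
        using q by (intro mult_right_mono powr_mono) auto
      finally have "real (k i) powr (1 / ?q) * v i \<le> 2 * real (m i) powr (1 / ?q) * v i"
        using v(1)[of i] by (intro mult_right_mono) auto
      then have "4 ^ i \<le> 2 * (real (m i) powr (1 / ?q) * v i)" using large[of i] by (simp add: v_def)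
      then have "(1/2) ^ Suc i * 4 ^ i \<le> (1/2) ^ Suc i * (2 * (real (m i) powr (1 / ?q) * v i))"
        by (intro mult_left_mono) auto
      also have "\<dots> = 2 * (real (m i) powr (1 / ?q) * ((1/2) ^ Suc i * v i))" by simp
      also have "\<dots> \<le> 2 * M" using I(3) M[OF n I(1,2)] by (intro mult_left_mono) auto
      also have "(1/2) ^ Suc i * 4 ^ i = (2 ^ i / 2 :: real)"
        by (simp add: power_mult_distrib[symmetric] flip: power_mult_distrib)
      finally show ?thesis by simp
    qed
    moreover obtain i :: nat where "4 * M < 2 ^ i" using real_arch_pow[of 2 "4 * M"] by auto
    ultimately show False by (metis not_le pos_divide_le_eq mult.commute zero_less_numeral)
  qed
  ultimately show ?thesis by blast
qed

theorem corollary1p9: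
  fixes \<phi> :: "real \<Rightarrow> real" and lam qs \<delta> :: "nat \<Rightarrow> real" and q :: ereal
  assumes "strict_mono_on {0..} \<phi>" and "convex_on {0..} \<phi>" and "\<phi> 0 = 0"
    and "waterman_seq lam"
    and "\<And>n. n \<ge> 1 \<Longrightarrow> 1 \<le> qs n" and "mono_on {1..} qs"
    and "(\<lambda>n. ereal (qs n)) \<longlonglongrightarrow> q"
    and "\<And>n. n \<ge> 1 \<Longrightarrow> 2 \<le> \<delta> n" and "mono_on {1..} \<delta>"
    and "filterlim \<delta> at_top sequentially"
  shows "phi_Lambda_BV \<phi> lam \<subseteq> BV_seq qs \<delta> \<longleftrightarrow>
    limsup (\<lambda>n. ereal (MAX k\<in>{k::nat. 1 \<le> k \<and> real k \<le> \<delta> n}.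
      real k powr (1 / qs n) * the_inv_into {0..} \<phi> (inverse (waterman_sum lam k)))) < \<infinity>"
proof -
  define b where "b n k = real k powr (1 / qs n) *
    the_inv_into {0..} \<phi> (inverse (waterman_sum lam k))" for n k
  define A where "A n = {k::nat. 1 \<le> k \<and> real k \<le> \<delta> n}" for n
  have fin: "finite (A n)" for n
  proof (rule finite_subset)
    show "A n \<subseteq> {..nat \<lfloor>\<delta> n\<rfloor>}" by (auto simp: A_def le_nat_floor)
  qed simp
  have ne: "A n \<noteq> {}" if "1 \<le> n" for n
    using assms(8)[OF that] by (auto simp: A_def intro!: exI[of _ 1])
  have max_le: "(MAX k\<in>A n. b n k) \<le> K \<longleftrightarrow> (\<forall>k. 1 \<le> k \<longrightarrow> real k \<le> \<delta> n \<longrightarrow> b n k \<le> K)"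
    if "1 \<le> n" for n K
    using fin[of n] ne[OF that] by (subst Max_le_iff) (auto simp: A_def)
  have "phi_Lambda_BV \<phi> lam \<subseteq> BV_seq qs \<delta> \<longleftrightarrow> (\<exists>K. \<forall>n\<ge>1. (MAX k\<in>A n. b n k) \<le> K)"
  proof
    assume sub: "phi_Lambda_BV \<phi> lam \<subseteq> BV_seq qs \<delta>"
    show "\<exists>K. \<forall>n\<ge>1. (MAX k\<in>A n. b n k) \<le> K"
    proof (rule ccontr)
      assume "\<not> ?thesis"
      then have "\<exists>n k. 1 \<le> n \<and> 1 \<le> k \<and> real k \<le> \<delta> n \<and> K < b n k" for K
        using max_le by (metis not_le)
      then have "\<exists>f. f \<in> phi_Lambda_BV \<phi> lam \<and> f \<notin> BV_seq qs \<delta>"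
        unfolding b_def by (intro ex_phi_Lambda_BV_not_BV_seq assms)
      then show False using sub by blast
    qed
  next
    assume "\<exists>K. \<forall>n\<ge>1. (MAX k\<in>A n. b n k) \<le> K"
    then obtain K where K: "\<And>n k. 1 \<le> n \<Longrightarrow> 1 \<le> k \<Longrightarrow> real k \<le> \<delta> n \<Longrightarrow> b n k \<le> max K 1"
      using max_le by (metis max.coboundedI1)
    show "phi_Lambda_BV \<phi> lam \<subseteq> BV_seq qs \<delta>"
    proof
      fix f assume "f \<in> phi_Lambda_BV \<phi> lam"
      then obtain c M where c: "0 < c" and M: "\<And>s I. nonoverlapping_intervals s I \<Longrightarrow>
          (\<Sum>j=1..s. \<phi> (c * \<bar>increment f (I j)\<bar>) / lam j) \<le> M"
        unfolding phi_Lambda_BV_iff by blast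
      have M': "nonoverlapping_intervals s I \<Longrightarrow>
          (\<Sum>j=1..s. \<phi> (c * \<bar>increment f (I j)\<bar>) / lam j) \<le> max M 1" for s I
        using M[of s I] by simp
      show "f \<in> BV_seq qs \<delta>"
        unfolding BV_seq_iff
      proof (intro exI allI impI)
        fix n s I assume n: "(1::nat) \<le> n" and I: "nonoverlapping_intervals s I"
          and len: "\<forall>j\<in>{1..s}. len (I j) \<ge> 1 / \<delta> n"
        show "(\<Sum>j=1..s. \<bar>increment f (I j)\<bar> powr qs n) powr (1 / qs n) \<le> 3 * max K 1 * max M 1 / c"
          using K[OF n] len assms(8)[OF n] unfolding b_def
          by (intro powr_variation_le[OF assms(1-4) assms(5)[OF n] _ c _ M' _ _ I, where d = "\<delta> n"]) auto
      qed
    qed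
  qed
  then show ?thesis unfolding limsup_ereal_less_PInf_iff A_def b_def .
qed

end
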